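(* Let $\lambda>0$, $r>0$, $h(x)=x_1^2+x_2^2-r^2$, and consider on the open quadrant $Q=\{x\in\mathbb R^2: x_1<0,\ x_2<0\}$ the system $$\dot x_1=-\frac{\lambda}{4x_1}h(x),\qquad \dot x_2=-\frac{\lambda}{4x_2}h(x).$$ Then: (i) the set of equilibria in $Q$ is exactly the arc $\{x\in Q: h(x)=0\}$; (ii) along solutions, $\dot h=-\lambda h$, and the function $g(x)=x_1^2-x_2^2$ is constant; moreover a level set $\{x \in Q: g(x)=c\}$ intersects the arc $\{x\in Q:h(x)=0\}$ if $|c|<r^2$; (iii) at every equilibrium $x_e\in Q$ the Jacobian matrix of the right-hand side has eigenvalues $0$ and $-\lambda$; (iv) every equilibrium $x_e\in Q$ is stable (in the sense of Lyapunov).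
   Context: The system is the joint closed-loop dynamics of two agents on perpendicular lines, $\dot x_i=v_i$ ($i=1,2$, $x_i$ the signed distance from the intersection point), under the Decentralized Reciprocal collision avoidance policy when both agents' constraints are active: agent $i$ minimizes $\|v_i-v_{0i}\|^2$ subject to $\frac{\lambda}{2}h+2x_iv_i\ge 0$, where $v_{0i}>0$ is its desired velocity. The Decentralized Follower policy gives the same system with $\lambda$ replaced by $2\lambda$. The claim itself concerns only the displayed differential equation. *)

theory Defs
  imports "HOL-Analysis.Analysis"
begin

definition quadrant :: "(real^2) set" where
  "quadrant = {x. x $ 1 < 0 \<and> x $ 2 < 0}"

definition barrier :: "real \<Rightarrow> real^2 \<Rightarrow> real" where
  "barrier r x = (x $ 1)\<^sup>2 + (x $ 2)\<^sup>2 - r\<^sup>2"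

definition first_int :: "real^2 \<Rightarrow> real" where
  "first_int x = (x $ 1)\<^sup>2 - (x $ 2)\<^sup>2"

definition closed_loop :: "real \<Rightarrow> real \<Rightarrow> real^2 \<Rightarrow> real^2" where
  "closed_loop lam r x =
     vector [- (lam / (4 * x $ 1)) * barrier r x,
             - (lam / (4 * x $ 2)) * barrier r x]"

(* Solutions of x' = f x on the interval T with values in Q; at an endpoint
   belonging to T the derivative is one-sided. *)
definition is_solution ::
  "('a::real_normed_vector \<Rightarrow> 'a) \<Rightarrow> 'a set \<Rightarrow> real set \<Rightarrow> (real \<Rightarrow> 'a) \<Rightarrow> bool" where
  "is_solution f Q T x \<longleftrightarrow> is_interval T \<and>
     (\<forall>t\<in>T. x t \<in> Q \<and> (x has_vector_derivative f (x t)) (at t within T))"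

definition equilibria :: "('a::real_normed_vector \<Rightarrow> 'a) \<Rightarrow> 'a set \<Rightarrow> 'a set" where
  "equilibria f Q = {x \<in> Q. f x = 0}"

(* Sufficiently close to xe, a solution exists for all t >= 0, and every forward
   solution, on whatever interval, stays in the given ball. The existence clause
   rules out vacuous stability. *)
definition lyapunov_stable ::
  "('a::real_normed_vector \<Rightarrow> 'a) \<Rightarrow> 'a set \<Rightarrow> 'a \<Rightarrow> bool" where
  "lyapunov_stable f Q xe \<longleftrightarrow>
     (\<forall>e>0. \<exists>d>0. \<forall>x0\<in>Q. dist x0 xe < d \<longrightarrow>
        (\<exists>x. is_solution f Q {0..} x \<and> x 0 = x0) \<and>
        (\<forall>T x. is_solution f Q T x \<and> 0 \<in> T \<and> T \<subseteq> {0..} \<and> x 0 = x0 \<longrightarrow>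
           (\<forall>t\<in>T. dist (x t) xe < e)))"

definition eigenvalues :: "real^'n^'n \<Rightarrow> real set" where
  "eigenvalues A = {m. \<exists>v. v \<noteq> 0 \<and> A *v v = m *s v}"

end

(* Along a solution h decays like exp (- lam * t) and g is constant, so x_i^2 moves by
   (h (x t) - h (x 0)) / 2, which is at most |h (x 0)| / 2 in absolute value. As x_i
   keeps its sign, x_i itself moves by at most |h (x 0)| / (2 * |x_i 0|). This bound is
   continuous in the initial value and vanishes at equilibria, which gives stability. The
   same formula for x_i^2, solved for x_i < 0, provides a global forward solution. *)
theory Submission
  imports Defs
begin

section \<open>Coordinates, equilibria and elementary estimates\<close>

lemma vec2_eq_axis_sum: "(vector [a, b] :: real^2) = a *\<^sub>R axis 1 1 + b *\<^sub>R axis 2 1"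
  by (simp add: vec_eq_iff forall_2 axis_def)

lemma closed_loop_nth [simp]:
  "closed_loop lam r x $ 1 = - (lam / (4 * x $ 1)) * barrier r x"
  "closed_loop lam r x $ 2 = - (lam / (4 * x $ 2)) * barrier r x"
  by (simp_all add: closed_loop_def)

lemma equilibria_closed_loop:
  assumes "lam > 0"
  shows "equilibria (closed_loop lam r) quadrant = {x \<in> quadrant. barrier r x = 0}"
  using assms by (auto simp: equilibria_def quadrant_def vec_eq_iff forall_2)

text \<open>Factor t^2 - s^2 = (t - s) * (t + s); as s and t have the same sign, |t + s| is at least
  |s|. This turns control of squares into control of coordinates.\<close>

lemma dist_neg_le:
  fixes s t :: real
  assumes "s < 0" "t < 0"
  shows "\<bar>t - s\<bar> \<le> \<bar>t\<^sup>2 - s\<^sup>2\<bar> / \<bar>s\<bar>"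
proof -
  have "\<bar>t - s\<bar> * \<bar>s\<bar> \<le> \<bar>t - s\<bar> * \<bar>t + s\<bar>"
    using assms by (intro mult_left_mono) auto
  also have "\<dots> = \<bar>t\<^sup>2 - s\<^sup>2\<bar>"
    by (simp add: abs_mult[symmetric] power2_eq_square algebra_simps)
  finally show ?thesis
    using assms by (simp add: field_simps)
qed

lemma dist_vec2_le:
  fixes x y :: "real^2"
  shows "dist x y \<le> \<bar>x $ 1 - y $ 1\<bar> + \<bar>x $ 2 - y $ 2\<bar>"
  using norm_le_l1_cart[of "x - y"] by (simp add: dist_norm sum_2)

section \<open>Evolution of the barrier and the first integral along solutions\<close>

lemma solution_nth_derivative:
  assumes "is_solution (closed_loop lam r) quadrant T x" "t \<in> T"
  shows "((\<lambda>s. x s $ 1) has_real_derivative - (lam / (4 * x t $ 1)) * barrier r (x t)) (at t within T)"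
    and "((\<lambda>s. x s $ 2) has_real_derivative - (lam / (4 * x t $ 2)) * barrier r (x t)) (at t within T)"
proof -
  have "(x has_vector_derivative closed_loop lam r (x t)) (at t within T)"
    using assms by (auto simp: is_solution_def)
  from bounded_linear.has_vector_derivative[OF bounded_linear_vec_nth this, of 1]
    bounded_linear.has_vector_derivative[OF bounded_linear_vec_nth this, of 2]
  show "((\<lambda>s. x s $ 1) has_real_derivative - (lam / (4 * x t $ 1)) * barrier r (x t)) (at t within T)"
    and "((\<lambda>s. x s $ 2) has_real_derivative - (lam / (4 * x t $ 2)) * barrier r (x t)) (at t within T)"
    by (simp_all add: has_real_derivative_iff_has_vector_derivative)
qed

lemma solution_nth_neg:
  assumes "is_solution (closed_loop lam r) quadrant T x" "t \<in> T"
  shows "x t $ 1 < 0" "x t $ 2 < 0"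
  using assms by (auto simp: is_solution_def quadrant_def)

text \<open>In the derivative of x_i^2 the factor x_i cancels the 1 / x_i of the vector field, so
  both squares have derivative - (lam / 2) * h. Their sum gives this lemma, their difference the
  next one.\<close>

lemma barrier_derivative:
  assumes "is_solution (closed_loop lam r) quadrant T x" "t \<in> T"
  shows "((\<lambda>s. barrier r (x s)) has_real_derivative - lam * barrier r (x t)) (at t within T)"
proof -
  have "((\<lambda>s. (x s $ 1)\<^sup>2 + (x s $ 2)\<^sup>2 - r\<^sup>2) has_real_derivative - lam * barrier r (x t))
      (at t within T)"
    using solution_nth_neg[OF assms]
    by (auto intro!: derivative_eq_intros solution_nth_derivative[OF assms])
  then show ?thesis
    by (simp add: barrier_def[abs_def])
qed

lemma first_int_derivative:
  assumes "is_solution (closed_loop lam r) quadrant T x" "t \<in> T"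
  shows "((\<lambda>s. first_int (x s)) has_real_derivative 0) (at t within T)"
proof -
  have "((\<lambda>s. (x s $ 1)\<^sup>2 - (x s $ 2)\<^sup>2) has_real_derivative 0) (at t within T)"
    using solution_nth_neg[OF assms]
    by (auto intro!: derivative_eq_intros solution_nth_derivative[OF assms])
  then show ?thesis
    by (simp add: first_int_def[abs_def])
qed

lemma constant_on_interval:
  fixes f :: "real \<Rightarrow> real"
  assumes "is_interval T" "\<And>t. t \<in> T \<Longrightarrow> (f has_real_derivative 0) (at t within T)"
  shows "f constant_on T"
  using has_field_derivative_zero_constant[of T f] assms
  by (auto simp: constant_on_def is_interval_convex_1)

lemma first_int_constant:
  assumes "is_solution (closed_loop lam r) quadrant T x"
  shows "(\<lambda>t. first_int (x t)) constant_on T"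
proof (rule constant_on_interval)
  show "is_interval T"
    using assms by (simp add: is_solution_def)
qed (rule first_int_derivative[OF assms])

lemma barrier_solution:
  assumes sol: "is_solution (closed_loop lam r) quadrant T x" and "0 \<in> T" "t \<in> T"
  shows "barrier r (x t) = barrier r (x 0) * exp (- lam * t)"
proof -
  \<comment> \<open>Integrating factor for h' = - lam * h.\<close>
  have "(\<lambda>t. barrier r (x t) * exp (lam * t)) constant_on T"
  proof (rule constant_on_interval)
    show "is_interval T"
      using sol by (simp add: is_solution_def)
  qed (auto intro!: derivative_eq_intros barrier_derivative[OF sol] simp: algebra_simps)
  then have "barrier r (x t) * exp (lam * t) = barrier r (x 0) * exp (lam * 0)"
    using assms unfolding constant_on_def by metis
  then show ?thesis
    by (simp add: exp_minus field_simps)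
qed

lemma solution_dist_le:
  assumes sol: "is_solution (closed_loop lam r) quadrant T x"
    and "lam > 0" "0 \<in> T" "T \<subseteq> {0..}" "t \<in> T"
  shows "dist (x t) (x 0)
    \<le> \<bar>barrier r (x 0)\<bar> / (2 * \<bar>x 0 $ 1\<bar>) + \<bar>barrier r (x 0)\<bar> / (2 * \<bar>x 0 $ 2\<bar>)"
proof -
  let ?h = "barrier r (x 0)"
  have g: "first_int (x t) = first_int (x 0)"
    using first_int_constant[OF sol] assms unfolding constant_on_def by metis
  have "t \<ge> 0"
    using assms by auto
  \<comment> \<open>Only forward times give this range: for t < 0 the factor is negative and
    unbounded.\<close>
  then have "0 \<le> 1 - exp (- lam * t)" "1 - exp (- lam * t) \<le> 1"
    using \<open>lam > 0\<close> by auto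
  moreover have "barrier r (x t) - ?h = - (?h * (1 - exp (- lam * t)))"
    unfolding barrier_solution[OF sol \<open>0 \<in> T\<close> \<open>t \<in> T\<close>] by (simp add: algebra_simps)
  ultimately have h: "\<bar>barrier r (x t) - ?h\<bar> \<le> \<bar>?h\<bar>"
    by (simp add: abs_mult mult_left_le)
  \<comment> \<open>Twice the squares are r^2 + h + g and r^2 + h - g. As g is constant, each square
    changes by half the change of h.\<close>
  have sq: "\<bar>(x t $ 1)\<^sup>2 - (x 0 $ 1)\<^sup>2\<bar> \<le> \<bar>?h\<bar> / 2" "\<bar>(x t $ 2)\<^sup>2 - (x 0 $ 2)\<^sup>2\<bar> \<le> \<bar>?h\<bar> / 2"
    using g h unfolding first_int_def barrier_def by argo+
  have "\<bar>x t $ i - x 0 $ i\<bar> \<le> \<bar>?h\<bar> / (2 * \<bar>x 0 $ i\<bar>)" if "i = 1 \<or> i = 2" for i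
  proof -
    have "\<bar>x t $ i - x 0 $ i\<bar> \<le> \<bar>(x t $ i)\<^sup>2 - (x 0 $ i)\<^sup>2\<bar> / \<bar>x 0 $ i\<bar>"
      using that solution_nth_neg[OF sol] assms by (intro dist_neg_le) auto
    also have "\<dots> \<le> (\<bar>?h\<bar> / 2) / \<bar>x 0 $ i\<bar>"
      using that sq by (intro divide_right_mono) auto
    finally show ?thesis
      by simp
  qed
  from this[of 1] this[of 2] show ?thesis
    using dist_vec2_le[of "x t" "x 0"] by simp
qed

section \<open>Global forward solutions\<close>

lemma forward_solution_exists:
  assumes "lam > 0" "x0 \<in> quadrant"
    and small: "barrier r x0 / 2 < (x0 $ 1)\<^sup>2" "barrier r x0 / 2 < (x0 $ 2)\<^sup>2"
  shows "\<exists>x. is_solution (closed_loop lam r) quadrant {0..} x \<and> x 0 = x0"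
proof -
  define h where "h = barrier r x0"
  \<comment> \<open>The value forced on the square of a coordinate that starts at \<open>a\<close>,
    given that h decays exponentially.\<close>
  define u where "u a t = a\<^sup>2 - h / 2 * (1 - exp (- lam * t))" for a t :: real
  define x :: "real \<Rightarrow> real^2"
    where "x t = vector [- sqrt (u (x0 $ 1) t), - sqrt (u (x0 $ 2) t)]" for t
  \<comment> \<open>For h \<le> 0 the square never falls below \<open>a\<^sup>2\<close>. Otherwise
    it stays at or above its limit \<open>a\<^sup>2 - h / 2\<close>, which the assumption
    \<open>small\<close> makes positive; so no coordinate reaches 0.\<close>
  have u_pos: "u a t > 0" if "h / 2 < a\<^sup>2" "a < 0" "t \<ge> 0" for a t
  proof (cases "h \<le> 0")
    case True
    then have "h / 2 * (1 - exp (- lam * t)) \<le> 0"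
      using \<open>lam > 0\<close> that by (intro mult_nonpos_nonneg) auto
    moreover have "a\<^sup>2 > 0"
      using that by simp
    ultimately show ?thesis
      unfolding u_def by linarith
  next
    case False
    then have "h / 2 * (1 - exp (- lam * t)) \<le> h / 2"
      by (intro mult_left_le) auto
    then show ?thesis
      using that unfolding u_def by linarith
  qed
  have neg: "x0 $ 1 < 0" "x0 $ 2 < 0"
    using assms by (auto simp: quadrant_def)
  have pos: "u (x0 $ 1) t > 0" "u (x0 $ 2) t > 0" if "t \<ge> 0" for t
    using u_pos neg small that by (auto simp: h_def)
  have bar: "barrier r (x t) = h * exp (- lam * t)" if "t \<ge> 0" for t
    using pos[OF that]
    \<comment> \<open>\<open>u\<close> is unfolded only once the squared roots are gone, because the
      positivity facts are stated for \<open>u\<close>.\<close>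
    by (simp add: barrier_def x_def) (simp add: u_def h_def barrier_def algebra_simps)
  \<comment> \<open>The denominator keeps the form \<open>4 * - sqrt (u a t)\<close>, so that the
    derivative matches the vector field literally when the two coordinates are reassembled by
    \<open>simp only\<close>.\<close>
  have du: "((\<lambda>t. - sqrt (u a t)) has_vector_derivative
      - (lam / (4 * - sqrt (u a t))) * (h * exp (- lam * t))) (at t within {0..})"
    if "u a t > 0" for a t
    using that unfolding has_real_derivative_iff_has_vector_derivative[symmetric] u_def
    by (auto intro!: derivative_eq_intros simp: field_simps)
  have "(x has_vector_derivative closed_loop lam r (x t)) (at t within {0..})" if "t \<ge> 0" for t
  proof -
    have "closed_loop lam r (x t) =
        (- (lam / (4 * - sqrt (u (x0 $ 1) t))) * (h * exp (- lam * t))) *\<^sub>R axis 1 1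
      + (- (lam / (4 * - sqrt (u (x0 $ 2) t))) * (h * exp (- lam * t))) *\<^sub>R axis 2 1"
      using bar[OF that] unfolding closed_loop_def vec2_eq_axis_sum by (simp add: x_def)
    moreover have "x = (\<lambda>t. (- sqrt (u (x0 $ 1) t)) *\<^sub>R axis 1 1 + (- sqrt (u (x0 $ 2) t)) *\<^sub>R axis 2 1)"
      by (simp add: x_def[abs_def] vec2_eq_axis_sum)
    ultimately show ?thesis
      using pos[OF that]
      by (simp only:)
        (intro has_vector_derivative_add du
          bounded_linear.has_vector_derivative[OF bounded_linear_scaleR_left])
  qed
  moreover have "x t \<in> quadrant" if "t \<ge> 0" for t
    using pos[OF that] by (simp add: quadrant_def x_def)
  moreover have "x 0 = x0"
    using neg by (simp add: x_def u_def vec_eq_iff forall_2)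
  ultimately show ?thesis
    by (auto simp: is_solution_def is_interval_ci)
qed

section \<open>Lyapunov stability\<close>

lemma isCont_barrier: "isCont (barrier r) x"
  unfolding barrier_def[abs_def] by (intro continuous_intros)

lemma lyapunov_stable_closed_loop:
  assumes "lam > 0" "xe \<in> quadrant" "barrier r xe = 0"
  shows "lyapunov_stable (closed_loop lam r) quadrant xe"
  unfolding lyapunov_stable_def
proof (intro allI impI)
  fix e :: real assume "e > 0"
  have neg: "xe $ 1 < 0" "xe $ 2 < 0"
    using assms by (auto simp: quadrant_def)
  \<comment> \<open>By the triangle inequality, \<open>F x\<close> bounds the distance to
    \<open>xe\<close> along every forward solution starting at \<open>x\<close>.\<close>
  define F where "F x = dist x xe
    + (\<bar>barrier r x\<bar> / (2 * \<bar>x $ 1\<bar>) + \<bar>barrier r x\<bar> / (2 * \<bar>x $ 2\<bar>))" for x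
  \<comment> \<open>Limits are taken along \<open>nhds xe\<close>, not \<open>at xe\<close>, since
    the initial value may be \<open>xe\<close> itself.\<close>
  have bar: "(barrier r \<longlongrightarrow> barrier r xe) (nhds xe)"
    using isCont_barrier continuous_at tendsto_at_iff_tendsto_nhds by blast
  have nth: "((\<lambda>x. x $ i) \<longlongrightarrow> xe $ i) (nhds xe)" for i
    by (intro tendsto_intros filterlim_ident)
  have "(F \<longlongrightarrow> F xe) (nhds xe)"
    unfolding F_def using neg
    by (intro tendsto_intros bar nth filterlim_ident) auto
  moreover have "F xe < e"
    using assms \<open>e > 0\<close> by (simp add: F_def)
  ultimately have "\<forall>\<^sub>F x in nhds xe. F x < e"
    by (rule order_tendstoD)
  \<comment> \<open>The smallness condition of \<open>forward_solution_exists\<close>. It holds at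
    \<open>xe\<close>, where the barrier vanishes, and persists nearby by continuity.\<close>
  moreover have "\<forall>\<^sub>F x in nhds xe. 0 < (x $ i)\<^sup>2 - barrier r x / 2" if "xe $ i < 0" for i
    using assms that
    by (intro order_tendstoD(1)[of _ "(xe $ i)\<^sup>2 - barrier r xe / 2"] tendsto_intros bar nth) auto
  ultimately have "\<forall>\<^sub>F x in nhds xe. F x < e
      \<and> 0 < (x $ 1)\<^sup>2 - barrier r x / 2 \<and> 0 < (x $ 2)\<^sup>2 - barrier r x / 2"
    using neg by (intro eventually_conj) auto
  then obtain d where "d > 0" and d: "\<And>x. dist x xe < d \<Longrightarrow> F x < e
      \<and> 0 < (x $ 1)\<^sup>2 - barrier r x / 2 \<and> 0 < (x $ 2)\<^sup>2 - barrier r x / 2"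
    unfolding eventually_nhds_metric by blast
  show "\<exists>d>0. \<forall>x0\<in>quadrant. dist x0 xe < d \<longrightarrow>
        (\<exists>x. is_solution (closed_loop lam r) quadrant {0..} x \<and> x 0 = x0) \<and>
        (\<forall>T x. is_solution (closed_loop lam r) quadrant T x \<and> 0 \<in> T \<and> T \<subseteq> {0..} \<and> x 0 = x0 \<longrightarrow>
           (\<forall>t\<in>T. dist (x t) xe < e))"
  proof (rule exI[of _ d], intro conjI ballI allI impI)
    fix x0 assume "x0 \<in> quadrant" "dist x0 xe < d"
    then show "\<exists>x. is_solution (closed_loop lam r) quadrant {0..} x \<and> x 0 = x0"
      using d by (intro forward_solution_exists \<open>lam > 0\<close>) fastforce+
  next
    fix x0 T x t
    assume "dist x0 xe < d" "t \<in> T"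
      and sol: "is_solution (closed_loop lam r) quadrant T x \<and> 0 \<in> T \<and> T \<subseteq> {0..} \<and> x 0 = x0"
    then have "F (x 0) < e"
      using d by auto
    moreover have "dist (x t) xe \<le> F (x 0)"
      using solution_dist_le[of lam r T x t] sol \<open>t \<in> T\<close> \<open>lam > 0\<close> dist_triangle[of "x t" xe "x 0"]
      unfolding F_def by force
    ultimately show "dist (x t) xe < e"
      by simp
  qed (rule \<open>d > 0\<close>)
qed

section \<open>Level sets of the first integral\<close>

lemma level_set_meets_arc:
  assumes "\<bar>c\<bar> < r\<^sup>2"
  shows "{x \<in> quadrant. first_int x = c} \<inter> {x \<in> quadrant. barrier r x = 0} \<noteq> {}"
proof -
  \<comment> \<open>The negative solution of x_1^2 + x_2^2 = r^2 and x_1^2 - x_2^2 = c.\<close>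
  let ?x = "vector [- sqrt ((r\<^sup>2 + c) / 2), - sqrt ((r\<^sup>2 - c) / 2)] :: real^2"
  have "r\<^sup>2 + c > 0" "r\<^sup>2 - c > 0"
    using assms by auto
  then have "?x \<in> {x \<in> quadrant. first_int x = c} \<inter> {x \<in> quadrant. barrier r x = 0}"
    by (simp add: quadrant_def first_int_def barrier_def field_simps)
  then show ?thesis
    by blast
qed

section \<open>Linearization at equilibria\<close>

lemma closed_loop_has_derivative:
  assumes "xe \<in> quadrant" "barrier r xe = 0"
  shows "(closed_loop lam r has_derivative
    (\<lambda>v. vector [- (lam / 2) * (xe $ 1 * v $ 1 + xe $ 2 * v $ 2) / xe $ 1,
                 - (lam / 2) * (xe $ 1 * v $ 1 + xe $ 2 * v $ 2) / xe $ 2])) (at xe)"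
proof -
  have neg: "xe $ 1 < 0" "xe $ 2 < 0"
    using assms by (auto simp: quadrant_def)
  have nth: "((\<lambda>x. x $ i) has_derivative (\<lambda>v. v $ i)) (at xe)" for i
    by (rule bounded_linear_imp_has_derivative[OF bounded_linear_vec_nth])
  have bar: "(barrier r has_derivative (\<lambda>v. 2 * (xe $ 1 * v $ 1 + xe $ 2 * v $ 2))) (at xe)"
    unfolding barrier_def[abs_def] by (auto intro!: derivative_eq_intros nth simp: algebra_simps)
  \<comment> \<open>In the product rule the term that differentiates 1 / x_i carries the factor
    \<open>barrier r xe = 0\<close>; only the derivative of the barrier survives.\<close>
  have "((\<lambda>x. - (lam / (4 * x $ i)) * barrier r x) has_derivative
      (\<lambda>v. - (lam / 2) * (xe $ 1 * v $ 1 + xe $ 2 * v $ 2) / xe $ i)) (at xe)" if "xe $ i < 0" for i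
    using that assms(2) by (auto intro!: derivative_eq_intros nth bar simp: field_simps)
  note this[OF neg(1)] this[OF neg(2)]
  then show ?thesis
    unfolding closed_loop_def[abs_def] vec2_eq_axis_sum
    by (intro has_derivative_add has_derivative_scaleR_left)
qed

lemma eigenvalues_closed_loop:
  assumes "xe \<in> quadrant" "barrier r xe = 0"
  shows "eigenvalues (jacobian (closed_loop lam r) (at xe)) = {0, - lam}"
proof -
  \<comment> \<open>Half the derivative of the barrier at \<open>xe\<close>. \<open>D\<close>
    depends on \<open>v\<close> only through \<open>s v\<close>.\<close>
  define s where "s v = xe $ 1 * v $ 1 + xe $ 2 * v $ 2" for v :: "real^2"
  define D :: "real^2 \<Rightarrow> real^2"
    where "D v = vector [- (lam / 2) * s v / xe $ 1, - (lam / 2) * s v / xe $ 2]" for v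
  have neg: "xe $ 1 < 0" "xe $ 2 < 0"
    using assms by (auto simp: quadrant_def)
  have der: "(closed_loop lam r has_derivative D) (at xe)"
    using closed_loop_has_derivative[OF assms] by (simp add: D_def[abs_def] s_def)
  have "jacobian (closed_loop lam r) (at xe) = matrix D"
    using frechet_derivative_at[OF der] by (simp add: jacobian_def)
  then have app: "jacobian (closed_loop lam r) (at xe) *v v = D v" for v
    using fun_cong[OF matrix_vector_mul(2)[OF has_derivative_linear[OF der]]] by simp
  show ?thesis
  proof (intro equalityI subsetI)
    fix m assume "m \<in> eigenvalues (jacobian (closed_loop lam r) (at xe))"
    then obtain v where "v \<noteq> 0" and v: "D v = m *s v"
      by (auto simp: eigenvalues_def app)
    \<comment> \<open>Multiplying the i-th eigenvector equation by the i-th coordinate of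
      \<open>xe\<close> makes the right-hand sides equal. Their sum then involves only
      \<open>s v\<close>.\<close>
    have mv: "m * (xe $ 1 * v $ 1) = - (lam / 2) * s v" "m * (xe $ 2 * v $ 2) = - (lam / 2) * s v"
      using v neg by (auto simp: vec_eq_iff forall_2 D_def field_simps)
    then have "m * s v = - lam * s v"
      by (simp add: s_def algebra_simps)
    moreover have "m = 0" if "s v = 0"
      using mv that neg \<open>v \<noteq> 0\<close> by (auto simp: vec_eq_iff forall_2)
    ultimately show "m \<in> {0, - lam}"
      by (metis insert_iff mult_right_cancel)
  next
    \<comment> \<open>\<open>?v\<close> is tangent to the arc, so \<open>s ?v = 0\<close>.
      \<open>?w\<close> spans the direction of all values of \<open>D\<close> and satisfies
      \<open>s ?w = 2\<close>, whence the eigenvalue - lam.\<close>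
    let ?v = "vector [xe $ 2, - xe $ 1] :: real^2" and ?w = "vector [1 / xe $ 1, 1 / xe $ 2] :: real^2"
    have "?v \<noteq> 0" "D ?v = 0 *s ?v" "?w \<noteq> 0" "D ?w = (- lam) *s ?w"
      using neg by (auto simp: vec_eq_iff forall_2 D_def s_def)
    then show "m \<in> eigenvalues (jacobian (closed_loop lam r) (at xe))" if "m \<in> {0, - lam}" for m
      using that unfolding eigenvalues_def app by blast
  qed
qed

theorem mainTheorem2:
  fixes lam r :: real
  assumes "lam > 0" and "r > 0"
  shows
    "equilibria (closed_loop lam r) quadrant = {x \<in> quadrant. barrier r x = 0}
   \<and> (\<forall>T x. is_solution (closed_loop lam r) quadrant T x \<longrightarrow>
         (\<forall>t\<in>T. ((\<lambda>s. barrier r (x s)) has_real_derivative - lam * barrier r (x t))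
                   (at t within T))
       \<and> (\<lambda>t. first_int (x t)) constant_on T)
   \<and> (\<forall>c. \<bar>c\<bar> < r\<^sup>2 \<longrightarrow>
         {x \<in> quadrant. first_int x = c} \<inter> {x \<in> quadrant. barrier r x = 0} \<noteq> {})
   \<and> (\<forall>xe \<in> equilibria (closed_loop lam r) quadrant.
         closed_loop lam r differentiable (at xe)
       \<and> eigenvalues (jacobian (closed_loop lam r) (at xe)) = {0, - lam})
   \<and> (\<forall>xe \<in> equilibria (closed_loop lam r) quadrant.
         lyapunov_stable (closed_loop lam r) quadrant xe)"
  using equilibria_closed_loop[OF assms(1)] barrier_derivative first_int_constant
    level_set_meets_arc eigenvalues_closed_loop lyapunov_stable_closed_loop[OF assms(1)]
    differentiableI[OF closed_loop_has_derivative]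
  by auto

end
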